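(* Let $y_1=(y_{11},\dots,y_{m1})^t\in\mathbb{Z}^m$ and let $X$ be the standardized abelian Cayley graph with Heuberger matrix the $m\times 1$ matrix $(y_1)$. If $y_1=\pm e_j$ for some $j$, then $X$ has loops and hence cannot be properly colored. Otherwise, $\chi(X)=2$ if $y_1$ has an even number of odd entries, and $\chi(X)=3$ if $y_1$ has an odd number of odd entries.
   Context: Given an $m\times r$ integer matrix $M$, let $H$ be the subgroup of $\mathbb{Z}^m$ generated by the columns of $M$, let $e_1,\dots,e_m$ be the standard basis of $\mathbb{Z}^m$, and $S=\{H\pm e_1,\dots,H\pm e_m\}$. The standardized abelian Cayley graph with Heuberger matrix $M$ is $\mathrm{Cay}(\mathbb{Z}^m/H,S)$ (vertices $\mathbb{Z}^m/H$, $x\sim y$ iff $x-y\in S$; loops allowed, no multiple edges). $\chi$ denotes chromatic number. *)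

theory Defs
  imports
    "HOL-Analysis.Analysis"
    "HOL-Algebra.Generated_Groups"
    "HOL-Library.Extended_Nat"
    "Graph_Theory.Pair_Digraph"
begin

text \<open>
  Graphs are symmetric digraphs without parallel arcs: an edge between \<open>x\<close> and \<open>y\<close> is the pair
  of arcs \<open>(x, y)\<close>, \<open>(y, x)\<close>, and a loop is an arc \<open>(x, x)\<close>.
\<close>

definition cayley_graph :: "('a, 'b) monoid_scheme \<Rightarrow> 'a set \<Rightarrow> 'a pair_pre_digraph" where
  "cayley_graph G S =
    \<lparr>pverts = carrier G,
     parcs = {(x, y). x \<in> carrier G \<and> y \<in> carrier G \<and> x \<otimes>\<^bsub>G\<^esub> inv\<^bsub>G\<^esub> y \<in> S}\<rparr>"

definition int_vec_group :: "(int ^ 'm) monoid" where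
  "int_vec_group = \<lparr>carrier = UNIV, monoid.mult = (+), one = 0\<rparr>"

definition heuberger_subgroup :: "int ^ 'r ^ 'm \<Rightarrow> (int ^ 'm) set" where
  "heuberger_subgroup M = generate int_vec_group (columns M)"

definition standard_connection_set :: "(int ^ 'm) set \<Rightarrow> (int ^ 'm) set set" where
  "standard_connection_set H =
    (\<Union>i. {H #>\<^bsub>int_vec_group\<^esub> axis i 1, H #>\<^bsub>int_vec_group\<^esub> (- axis i 1)})"

definition standardized_abelian_cayley_graph ::
    "int ^ 'r ^ 'm \<Rightarrow> (int ^ 'm) set pair_pre_digraph" where
  "standardized_abelian_cayley_graph M =
    (let H = heuberger_subgroup M
     in cayley_graph (int_vec_group Mod H) (standard_connection_set H))"

text \<open>A vertex carrying a loop violates the condition below for every \<open>c\<close>.\<close>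

definition proper_coloring :: "'a pair_pre_digraph \<Rightarrow> ('a \<Rightarrow> 'c) \<Rightarrow> bool" where
  "proper_coloring \<Gamma> c \<longleftrightarrow> (\<forall>u v. (u, v) \<in> parcs \<Gamma> \<longrightarrow> c u \<noteq> c v)"

text \<open>The value is \<open>\<infinity>\<close> if there is no proper colouring with finitely many colours.\<close>

definition chromatic_number :: "'a pair_pre_digraph \<Rightarrow> enat" where
  "chromatic_number \<Gamma> =
    (INF k \<in> {k. \<exists>c :: 'a \<Rightarrow> nat. proper_coloring \<Gamma> c \<and> c ` pverts \<Gamma> \<subseteq> {..<k}}. enat k)"

lemma comm_group_int_vec_group: "comm_group (int_vec_group :: (int ^ 'm) monoid)"
proof (rule comm_groupI)
  fix x :: "int ^ 'm"
  show "\<exists>y\<in>carrier int_vec_group. y \<otimes>\<^bsub>int_vec_group\<^esub> x = \<one>\<^bsub>int_vec_group\<^esub>"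
    by (rule bexI[of _ "- x"]) (simp_all add: int_vec_group_def)
qed (simp_all add: int_vec_group_def algebra_simps)

lemma inv_int_vec_group: "inv\<^bsub>int_vec_group\<^esub> x = - (x :: int ^ 'm)"
proof -
  interpret comm_group "int_vec_group :: (int ^ 'm) monoid" by (rule comm_group_int_vec_group)
  show ?thesis by (rule inv_equality) (simp_all add: int_vec_group_def)
qed

lemma normal_heuberger_subgroup:
  fixes M :: "int ^ 'r ^ 'm"
  shows "heuberger_subgroup M \<lhd> int_vec_group"
proof -
  interpret comm_group "int_vec_group :: (int ^ 'm) monoid" by (rule comm_group_int_vec_group)
  have "subgroup (heuberger_subgroup M) int_vec_group"
    unfolding heuberger_subgroup_def
    by (rule generate_is_subgroup) (simp add: int_vec_group_def)
  then show ?thesis by (rule subgroup_imp_normal)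
qed

lemma pair_sym_digraph_standardized_abelian_cayley_graph:
  fixes M :: "int ^ 'r ^ 'm"
  shows "pair_sym_digraph (standardized_abelian_cayley_graph M)"
proof -
  let ?Z = "int_vec_group :: (int ^ 'm) monoid"
  define H where "H = heuberger_subgroup M"
  interpret N: normal H ?Z
    unfolding H_def by (rule normal_heuberger_subgroup)
  interpret Q: group "?Z Mod H" by (rule N.factorgroup_is_group)
  have coset_in: "H #>\<^bsub>?Z\<^esub> a \<in> carrier (?Z Mod H)" for a
    by (auto simp: FactGroup_def RCOSETS_def int_vec_group_def)
  have inv_coset: "inv\<^bsub>?Z Mod H\<^esub> (H #>\<^bsub>?Z\<^esub> a) = H #>\<^bsub>?Z\<^esub> (- a)" for a
    using N.inv_FactGroup[OF coset_in, of a] N.rcos_inv[of a]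
    by (simp add: inv_int_vec_group) (simp add: int_vec_group_def)
  have S_inv: "inv\<^bsub>?Z Mod H\<^esub> s \<in> standard_connection_set H"
    if "s \<in> standard_connection_set H" for s
    using that by (auto simp: standard_connection_set_def inv_coset)
  have "y \<otimes>\<^bsub>?Z Mod H\<^esub> inv\<^bsub>?Z Mod H\<^esub> x \<in> standard_connection_set H"
    if "x \<in> carrier (?Z Mod H)" "y \<in> carrier (?Z Mod H)"
      "x \<otimes>\<^bsub>?Z Mod H\<^esub> inv\<^bsub>?Z Mod H\<^esub> y \<in> standard_connection_set H" for x y
    using S_inv[OF that(3)] that(1,2)
    by (simp only: Q.inv_mult_group Q.inv_closed Q.inv_inv)
  then show ?thesis
    by unfold_locales
      (auto simp: standardized_abelian_cayley_graph_def Let_def cayley_graph_def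
         symmetric_def sym_def simp flip: H_def)
qed

end

theory Submission
  imports Defs
begin

text \<open>
  A colouring of the Cayley graph is a colouring of \<open>\<int>\<^sup>m\<close> that is invariant under translation
  by \<open>y\<close> and changes along every basis vector. If the coordinate sum of \<open>y\<close> is even, the parity of the
  coordinate sum is such a colouring. If it is odd, a 2-colouring would have to be that parity up
  to swapping the colours, which \<open>y\<close> does not preserve; three colours suffice because
  \<open>e\<^sub>i \<mapsto> sgn y\<^sub>i\<close> (or \<open>1\<close> if \<open>y\<^sub>i = 0\<close>) maps the graph to the cycle of length
  \<open>n = \<Sum>\<bar>y\<^sub>i\<bar>\<close>, where \<open>n\<close> is odd, and \<open>n = 1\<close> happens only for \<open>y = \<plusminus> e\<^sub>j\<close>.
\<close>

text \<open>A colouring with values below some \<open>l \<le> k\<close> also has its values below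
  \<open>k\<close>, so excluding \<open>k\<close> excludes every smaller number of colours at
  once.\<close>

lemma chromatic_number_eqI:
  assumes "\<exists>c :: 'a \<Rightarrow> nat. proper_coloring \<Gamma> c \<and> c ` pverts \<Gamma> \<subseteq> {..<Suc k}"
    and "\<nexists>c :: 'a \<Rightarrow> nat. proper_coloring \<Gamma> c \<and> c ` pverts \<Gamma> \<subseteq> {..<k}"
  shows "chromatic_number \<Gamma> = enat (Suc k)"
proof (rule antisym)
  show "chromatic_number \<Gamma> \<le> enat (Suc k)"
    unfolding chromatic_number_def by (rule INF_lower) (use assms(1) in simp)
  show "enat (Suc k) \<le> chromatic_number \<Gamma>"
    unfolding chromatic_number_def
  proof (rule INF_greatest)
    fix l assume "l \<in> {k. \<exists>c :: 'a \<Rightarrow> nat. proper_coloring \<Gamma> c \<and> c ` pverts \<Gamma> \<subseteq> {..<k}}"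
    then obtain c :: "'a \<Rightarrow> nat" where "proper_coloring \<Gamma> c" "c ` pverts \<Gamma> \<subseteq> {..<l}" by blast
    with assms(2) have "\<not> l \<le> k" by (meson lessThan_subset_iff order_trans)
    then show "enat (Suc k) \<le> enat l" by simp
  qed
qed

section \<open>Vertices and arcs in terms of coset representatives\<close>

lemma pverts_standardized_abelian_cayley_graph:
  "pverts (standardized_abelian_cayley_graph M) =
     range (\<lambda>a. heuberger_subgroup M #>\<^bsub>int_vec_group\<^esub> a)"
  by (auto simp: standardized_abelian_cayley_graph_def Let_def cayley_graph_def FactGroup_def
      RCOSETS_def int_vec_group_def)

text \<open>Dividing by the coset of \<open>a\<close> in the quotient amounts to translating
  representatives by \<open>a\<close>. This moves adjacency from the quotient group to
  \<open>int ^ 'm\<close>, where the colourings are built.\<close>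

lemma parcs_standardized_abelian_cayley_graph_iff:
  fixes M :: "int ^ 'r ^ 'm"
  defines "H \<equiv> heuberger_subgroup M"
  shows "(X, Y) \<in> parcs (standardized_abelian_cayley_graph M) \<longleftrightarrow>
    (\<exists>a i. (X = H #>\<^bsub>int_vec_group\<^esub> (a + axis i 1) \<and> Y = H #>\<^bsub>int_vec_group\<^esub> a) \<or>
           (X = H #>\<^bsub>int_vec_group\<^esub> (a - axis i 1) \<and> Y = H #>\<^bsub>int_vec_group\<^esub> a))"
    (is "?L \<longleftrightarrow> ?R")
proof -
  let ?Z = "int_vec_group :: (int ^ 'm) monoid"
  interpret N: normal H ?Z
    unfolding H_def by (rule normal_heuberger_subgroup)
  interpret Q: group "?Z Mod H" by (rule N.factorgroup_is_group)
  have carrier: "carrier (?Z Mod H) = range (\<lambda>a. H #>\<^bsub>?Z\<^esub> a)"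
    by (auto simp: FactGroup_def RCOSETS_def int_vec_group_def)
  have mult: "(H #>\<^bsub>?Z\<^esub> a) \<otimes>\<^bsub>?Z Mod H\<^esub> (H #>\<^bsub>?Z\<^esub> b) = H #>\<^bsub>?Z\<^esub> (a + b)" for a b
    using N.rcos_sum[of a b] by (simp add: FactGroup_def int_vec_group_def)
  have shift: "X \<otimes>\<^bsub>?Z Mod H\<^esub> inv\<^bsub>?Z Mod H\<^esub> (H #>\<^bsub>?Z\<^esub> b) = H #>\<^bsub>?Z\<^esub> d \<longleftrightarrow>
      X = H #>\<^bsub>?Z\<^esub> (b + d)" if "X \<in> carrier (?Z Mod H)" for X b d
  proof -
    have "X \<otimes>\<^bsub>?Z Mod H\<^esub> inv\<^bsub>?Z Mod H\<^esub> (H #>\<^bsub>?Z\<^esub> b) = H #>\<^bsub>?Z\<^esub> d \<longleftrightarrow>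
        X = (H #>\<^bsub>?Z\<^esub> d) \<otimes>\<^bsub>?Z Mod H\<^esub> (H #>\<^bsub>?Z\<^esub> b)"
      using that Q.inv_solve_right[of "H #>\<^bsub>?Z\<^esub> d" X "H #>\<^bsub>?Z\<^esub> b"] by (auto simp: carrier)
    then show ?thesis by (simp only: mult add.commute)
  qed
  have "?L \<longleftrightarrow> X \<in> carrier (?Z Mod H) \<and> (\<exists>a. Y = H #>\<^bsub>?Z\<^esub> a \<and>
      (\<exists>i. X \<otimes>\<^bsub>?Z Mod H\<^esub> inv\<^bsub>?Z Mod H\<^esub> (H #>\<^bsub>?Z\<^esub> a) = H #>\<^bsub>?Z\<^esub> axis i 1 \<or>
           X \<otimes>\<^bsub>?Z Mod H\<^esub> inv\<^bsub>?Z Mod H\<^esub> (H #>\<^bsub>?Z\<^esub> a) = H #>\<^bsub>?Z\<^esub> (- axis i 1)))"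
    by (auto simp: standardized_abelian_cayley_graph_def Let_def cayley_graph_def
        standard_connection_set_def carrier simp flip: H_def)
  also have "\<dots> \<longleftrightarrow> X \<in> carrier (?Z Mod H) \<and> (\<exists>a. Y = H #>\<^bsub>?Z\<^esub> a \<and>
      (\<exists>i. X = H #>\<^bsub>?Z\<^esub> (a + axis i 1) \<or> X = H #>\<^bsub>?Z\<^esub> (a + - axis i 1)))"
    by (rule conj_cong) (simp_all only: shift)
  also have "\<dots> \<longleftrightarrow> ?R"
    unfolding carrier diff_conv_add_uminus by blast
  finally show ?thesis .
qed

section \<open>Colourings of cosets as invariant functions on integer vectors\<close>

lemma invariant_heuberger_subgroup:
  fixes M :: "int ^ 'r ^ 'm" and g :: "int ^ 'm \<Rightarrow> 'c"
  assumes "\<And>u v. u \<in> columns M \<Longrightarrow> g (v + u) = g v"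
    and "h \<in> heuberger_subgroup M"
  shows "g (v + h) = g v"
  using assms(2) unfolding heuberger_subgroup_def
\<comment> \<open>The base point stays arbitrary because the case of a sum \<open>h1 + h2\<close>
  uses the hypothesis for \<open>h2\<close> at \<open>v + h1\<close>.\<close>
proof (induction arbitrary: v rule: generate.induct)
  case one
  then show ?case by (simp add: int_vec_group_def)
next
  case (incl h)
  then show ?case by (rule assms(1))
next
  case (inv h)
  then show ?case using assms(1)[of h "v - h"] by (simp add: inv_int_vec_group)
next
  case (eng h1 h2)
  then show ?case by (simp add: int_vec_group_def flip: add.assoc)
qed

lemma mem_r_coset_heuberger_subgroup:
  fixes M :: "int ^ 'r ^ 'm"
  shows "x \<in> heuberger_subgroup M #>\<^bsub>int_vec_group\<^esub> a \<longleftrightarrow> x - a \<in> heuberger_subgroup M"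
  by (force simp: r_coset_def int_vec_group_def)

lemma r_coset_add_column:
  fixes M :: "int ^ 'r ^ 'm"
  assumes "u \<in> columns M"
  shows "heuberger_subgroup M #>\<^bsub>int_vec_group\<^esub> (a + u) =
    heuberger_subgroup M #>\<^bsub>int_vec_group\<^esub> a"
proof -
  let ?Z = "int_vec_group :: (int ^ 'm) monoid"
  interpret N: normal "heuberger_subgroup M" ?Z by (rule normal_heuberger_subgroup)
  have "u \<in> heuberger_subgroup M"
    using assms unfolding heuberger_subgroup_def by (rule generate.incl)
  then have "heuberger_subgroup M #>\<^bsub>?Z\<^esub> u = heuberger_subgroup M"
    by (rule N.rcos_const[OF N.is_group])
  then show ?thesis
    using N.coset_mult_assoc[of "heuberger_subgroup M" u a]
    by (simp add: int_vec_group_def add.commute)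
qed

text \<open>A colouring of the graph pulls back along the map sending a vector to its coset.
  Conversely, a function invariant under the columns is constant on cosets and descends to the
  quotient.\<close>

lemma ex_proper_coloring_iff:
  fixes M :: "int ^ 'r ^ 'm" and C :: "'c set"
  defines "\<Gamma> \<equiv> standardized_abelian_cayley_graph M"
  shows "(\<exists>c. proper_coloring \<Gamma> c \<and> c ` pverts \<Gamma> \<subseteq> C) \<longleftrightarrow>
    (\<exists>g :: int ^ 'm \<Rightarrow> 'c. range g \<subseteq> C \<and> (\<forall>v. \<forall>u \<in> columns M. g (v + u) = g v) \<and>
        (\<forall>v i. g (v + axis i 1) \<noteq> g v))"
    (is "?L \<longleftrightarrow> ?R")
proof
  let ?cos = "\<lambda>a. heuberger_subgroup M #>\<^bsub>int_vec_group\<^esub> a"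
  assume ?L
  then obtain c where c: "proper_coloring \<Gamma> c" "c ` pverts \<Gamma> \<subseteq> C" by blast
  have "(?cos (v + axis i 1), ?cos v) \<in> parcs \<Gamma>" for v i
    unfolding \<Gamma>_def parcs_standardized_abelian_cayley_graph_iff by blast
  then have "\<forall>v i. c (?cos (v + axis i 1)) \<noteq> c (?cos v)"
    using c(1) by (auto simp: proper_coloring_def)
  moreover have "range (\<lambda>v. c (?cos v)) \<subseteq> C"
    using c(2) by (auto simp: \<Gamma>_def pverts_standardized_abelian_cayley_graph)
  ultimately show ?R
    by (intro exI[of _ "\<lambda>v. c (?cos v)"]) (simp add: r_coset_add_column)
next
  let ?cos = "\<lambda>a. heuberger_subgroup M #>\<^bsub>int_vec_group\<^esub> a"
  assume ?R
  then obtain g :: "int ^ 'm \<Rightarrow> 'c" where g: "range g \<subseteq> C"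
      "\<And>u v. u \<in> columns M \<Longrightarrow> g (v + u) = g v" "\<And>v i. g (v + axis i 1) \<noteq> g v"
    by blast
  \<comment> \<open>Any representative of a coset gives the same value of \<open>g\<close>, so an
    arbitrary choice defines the colouring.\<close>
  define c where "c X = g (SOME v. v \<in> X)" for X
  have c: "c (?cos a) = g a" for a
  proof -
    have "0 \<in> heuberger_subgroup M"
      using generate.one[of int_vec_group "columns M"]
      by (simp add: heuberger_subgroup_def) (simp add: int_vec_group_def)
    then have "a \<in> ?cos a" by (simp add: mem_r_coset_heuberger_subgroup)
    then have "(SOME v. v \<in> ?cos a) \<in> ?cos a" by (rule someI)
    then have "(SOME v. v \<in> ?cos a) - a \<in> heuberger_subgroup M"
      by (simp only: mem_r_coset_heuberger_subgroup)
    from invariant_heuberger_subgroup[of M g, OF g(2) this, of a]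
    show ?thesis by (simp add: c_def)
  qed
  \<comment> \<open>An arc in the negative direction is a positive one that starts at
    \<open>v - axis i 1\<close>.\<close>
  have "g (v - axis i 1) \<noteq> g v" for v i
    using g(3)[of "v - axis i 1" i] by simp
  with g(3) have "proper_coloring \<Gamma> c"
    by (auto simp: proper_coloring_def \<Gamma>_def parcs_standardized_abelian_cayley_graph_iff c)
  moreover have "c ` pverts \<Gamma> \<subseteq> C"
    using g(1) by (auto simp: \<Gamma>_def pverts_standardized_abelian_cayley_graph c)
  ultimately show ?L by blast
qed

section \<open>Coordinate sums, parity and cycles\<close>

lemma axis_invariant_imp_constant:
  fixes h :: "int ^ 'm \<Rightarrow> 'c"
  assumes "\<And>v i. h (v + axis i 1) = h v"
  shows "h v = h 0"
proof -
  \<comment> \<open>The basis vectors generate all of \<open>int ^ 'm\<close>: first come the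
    integer multiples of one basis vector, by induction in both directions, and then their sums over
    the coordinates.\<close>
  have axis: "h (w + axis i k) = h w" for w i k
  proof (induction k arbitrary: w rule: int_induct[where k = 0])
    case base
    have "w + axis i 0 = w" by (simp add: vec_eq_iff axis_def)
    then show ?case by (simp only:)
  next
    case (step1 k)
    have "axis i (k + 1) = axis i k + (axis i 1 :: int ^ 'm)"
      by (simp add: vec_eq_iff axis_def)
    then show ?case using step1(2)[of w] assms[of "w + axis i k" i] by (simp add: add.assoc)
  next
    case (step2 k)
    have "axis i k = axis i (k - 1) + (axis i 1 :: int ^ 'm)"
      by (simp add: vec_eq_iff axis_def)
    then show ?case using step2(2)[of w] assms[of "w + axis i (k - 1)" i] by (simp add: add.assoc)
  qed
  have "h (\<Sum>i\<in>A. axis i (v $ i)) = h 0" if "finite A" for A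
    using that by (induction A) (simp_all add: axis add.commute[of "axis _ _"])
  moreover have "(\<Sum>i\<in>UNIV. axis i (v $ i)) = v"
    by (simp add: vec_eq_iff axis_def)
  ultimately show ?thesis using finite[of "UNIV :: 'm set"] by metis
qed

text \<open>The weights \<open>s\<close> cover two uses: all ones for the parity of the coordinate
  sum, and signs for the map onto a cycle.\<close>

lemma sum_nth_add_axis:
  fixes s :: "'m::finite \<Rightarrow> int"
  shows "(\<Sum>j\<in>UNIV. s j * (v + axis i 1) $ j) = (\<Sum>j\<in>UNIV. s j * v $ j) + s i"
  by (simp add: axis_def ring_distribs sum.distrib if_distrib[of "(*) _"] cong: if_cong)

text \<open>This links the parity condition on the odd entries to the coordinate sum, which the
  colouring arguments use.\<close>

lemma even_sum_nth_iff:
  fixes y :: "int ^ 'm"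
  shows "even (\<Sum>i\<in>UNIV. y $ i) \<longleftrightarrow> even (card {i. odd (y $ i)})"
  using even_sum_iff[of UNIV "\<lambda>i. y $ i"] by simp

text \<open>A nonzero integer entry already contributes at least 1, which leaves 0 for all the
  others.\<close>

lemma sum_abs_nth_eq_1D:
  fixes y :: "int ^ 'm"
  assumes "(\<Sum>i\<in>UNIV. \<bar>y $ i\<bar>) = 1"
  shows "\<exists>j. y = axis j 1 \<or> y = - axis j 1"
proof -
  obtain j where j: "y $ j \<noteq> 0"
    using assms by fastforce
  have "(\<Sum>i\<in>UNIV. \<bar>y $ i\<bar>) = \<bar>y $ j\<bar> + (\<Sum>i\<in>UNIV - {j}. \<bar>y $ i\<bar>)"
    by (rule sum.remove) auto
  moreover have "(\<Sum>i\<in>UNIV - {j}. \<bar>y $ i\<bar>) \<ge> 0" by (simp add: sum_nonneg)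
  ultimately have yj: "\<bar>y $ j\<bar> = 1" and "(\<Sum>i\<in>UNIV - {j}. \<bar>y $ i\<bar>) = 0"
    using j assms by linarith+
  then have "\<forall>i. i \<noteq> j \<longrightarrow> y $ i = 0"
    by (subst (asm) sum_nonneg_eq_0_iff) auto
  with yj have "y = axis j 1 \<or> y = - axis j 1"
    by (auto simp: vec_eq_iff axis_def abs_if split: if_splits)
  then show ?thesis by blast
qed

text \<open>The residues 0 to \<open>n - 2\<close> alternate between the colours 0 and 1. The third
  colour at \<open>n - 1\<close> repairs the wraparound, whatever the parity of
  \<open>n\<close>.\<close>

lemma cycle_3_coloring:
  fixes n :: int
  assumes "n \<ge> 2"
  defines "f \<equiv> \<lambda>t. if t mod n = n - 1 then 2 else nat (t mod n mod 2)"
  shows "f t < 3" and "f (t + n) = f t" and "f (t + 1) \<noteq> f t"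
proof -
  show "f t < 3"
  proof -
    have "t mod n mod 2 < 2" by simp
    then show ?thesis by (simp add: f_def nat_less_iff del: pos_mod_bound)
  qed
  show "f (t + n) = f t" by (simp add: f_def)
  define r where "r = t mod n"
  have r: "0 \<le> r" "r < n" using assms(1) by (simp_all add: r_def)
  have next_mod: "(t + 1) mod n = (if r = n - 1 then 0 else r + 1)"
  proof -
    have "(t + 1) mod n = (r + 1) mod n" by (simp add: r_def mod_simps)
    then show ?thesis using r by simp
  qed
  show "f (t + 1) \<noteq> f t"
  proof (cases "r = n - 1")
    case True
    \<comment> \<open>Since \<open>n \<ge> 2\<close>, residue 0 differs from \<open>n - 1\<close>
      and has colour 0, against colour 2 at \<open>t\<close>.\<close>
    then show ?thesis using assms(1) by (simp add: f_def next_mod flip: r_def)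
  next
    case False
    then have "f t = nat (r mod 2)" "f (t + 1) = (if r + 1 = n - 1 then 2 else nat ((r + 1) mod 2))"
      by (simp_all add: f_def next_mod flip: r_def)
    moreover have "r mod 2 = 0 \<and> (r + 1) mod 2 = 1 \<or> r mod 2 = 1 \<and> (r + 1) mod 2 = 0"
      by presburger
    ultimately show ?thesis by auto
  qed
qed

section \<open>Colourability with two and three colours\<close>

lemma ex_2_coloring:
  fixes y :: "int ^ 'm"
  assumes "even (\<Sum>i\<in>UNIV. y $ i)"
  shows "\<exists>g :: int ^ 'm \<Rightarrow> nat. range g \<subseteq> {..<2} \<and> (\<forall>v. g (v + y) = g v) \<and>
    (\<forall>v i. g (v + axis i 1) \<noteq> g v)"
proof (intro exI conjI allI)
  let ?g = "\<lambda>v :: int ^ 'm. of_bool (even (\<Sum>i\<in>UNIV. v $ i)) :: nat"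
  show "range ?g \<subseteq> {..<2}" by auto
  show "?g (v + y) = ?g v" for v using assms by (simp add: sum.distrib)
  show "?g (v + axis i 1) \<noteq> ?g v" for v i
    using sum_nth_add_axis[of "\<lambda>_. 1" v i] by simp
qed

lemma ex_3_coloring:
  fixes y :: "int ^ 'm"
  assumes "odd (\<Sum>i\<in>UNIV. y $ i)" and "\<nexists>j. y = axis j 1 \<or> y = - axis j 1"
  shows "\<exists>g :: int ^ 'm \<Rightarrow> nat. range g \<subseteq> {..<3} \<and> (\<forall>v. g (v + y) = g v) \<and>
    (\<forall>v i. g (v + axis i 1) \<noteq> g v)"
proof -
  define n where "n = (\<Sum>i\<in>UNIV. \<bar>y $ i\<bar>)"
  \<comment> \<open>These signs give \<open>\<phi> y = n\<close>. Zero entries get weight 1 rather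
    than 0, so that every basis vector moves \<open>\<phi>\<close> by 1 up or down.\<close>
  define s where "s i = (if y $ i < 0 then - 1 else 1 :: int)" for i
  define \<phi> where "\<phi> v = (\<Sum>i\<in>UNIV. s i * v $ i)" for v :: "int ^ 'm"
  define f where "f t = (if t mod n = n - 1 then 2 else nat (t mod n mod 2))" for t
  \<comment> \<open>Each absolute value has the parity of the entry itself.\<close>
  have "odd n"
    using assms(1) by (simp add: n_def even_sum_iff)
  moreover have "n \<noteq> 1"
    using sum_abs_nth_eq_1D assms(2) by (auto simp: n_def)
  moreover have "n \<ge> 0" by (simp add: n_def sum_nonneg)
  ultimately have n: "n \<ge> 2" by presburger
  note f = cycle_3_coloring[OF n, folded f_def]
  have "\<phi> y = n"
    unfolding \<phi>_def n_def by (rule sum.cong) (auto simp: s_def)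
  then have add_y: "\<phi> (v + y) = \<phi> v + n" for v
    by (simp add: \<phi>_def ring_distribs sum.distrib)
  have add_axis: "\<phi> (v + axis i 1) = \<phi> v + s i" for v i
    unfolding \<phi>_def by (rule sum_nth_add_axis)
  \<comment> \<open>For \<open>s i = - 1\<close> the step runs backwards along the cycle edge that
    starts at \<open>\<phi> v - 1\<close>.\<close>
  have "f (\<phi> (v + axis i 1)) \<noteq> f (\<phi> v)" for v i
    using f(3)[of "\<phi> v"] f(3)[of "\<phi> v - 1"] by (auto simp: add_axis s_def)
  then show ?thesis
    using f(1,2) by (intro exI[of _ "\<lambda>v. f (\<phi> v)"]) (auto simp: add_y)
qed

text \<open>With two colours available, every unit step swaps the colour and flips the parity of the
  coordinate sum. Whether the two parities agree is therefore constant along all steps from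
  \<open>v\<close>.\<close>

lemma no_2_coloring:
  fixes y :: "int ^ 'm" and g :: "int ^ 'm \<Rightarrow> nat"
  assumes "odd (\<Sum>i\<in>UNIV. y $ i)" and "range g \<subseteq> {..<2}"
    and "\<And>v i. g (v + axis i 1) \<noteq> g v"
  shows "g (v + y) \<noteq> g v"
proof -
  have lt: "g v < 2" for v using assms(2) by auto
  let ?h = "\<lambda>w. even (g (v + w)) \<longleftrightarrow> even (\<Sum>i\<in>UNIV. w $ i)"
  have "?h (w + axis i 1) = ?h w" for w i
  proof -
    have "even (g (v + (w + axis i 1))) \<noteq> even (g (v + w))"
      using assms(3)[of "v + w" i] lt[of "v + w"] lt[of "v + w + axis i 1"]
      by (auto simp: less_2_cases_iff add.assoc)
    then show ?thesis
      using sum_nth_add_axis[of "\<lambda>_. 1" w i] by auto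
  qed
  then have "?h y = ?h 0" by (rule axis_invariant_imp_constant)
  \<comment> \<open>At 0 the sum is even and at \<open>y\<close> it is odd, so
    \<open>g (v + y)\<close> and \<open>g v\<close> have opposite parity.\<close>
  with assms(1) show ?thesis by auto
qed

theorem theorem2p15:
  fixes y :: "int ^ 'm"
    and M :: "int ^ 1 ^ 'm"
    and \<Gamma> :: "(int ^ 'm) set pair_pre_digraph"
  assumes "M = columnvector y"
    and "\<Gamma> = standardized_abelian_cayley_graph M"
  shows "((\<exists>j. y = axis j 1 \<or> y = - axis j 1) \<longrightarrow>
            (\<exists>x \<in> pverts \<Gamma>. (x, x) \<in> parcs \<Gamma>) \<and>
            (\<nexists>c :: (int ^ 'm) set \<Rightarrow> 'c. proper_coloring \<Gamma> c)) \<and>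
         (\<not> (\<exists>j. y = axis j 1 \<or> y = - axis j 1) \<longrightarrow>
            (even (card {i. odd (y $ i)}) \<longrightarrow> chromatic_number \<Gamma> = 2) \<and>
            (odd (card {i. odd (y $ i)}) \<longrightarrow> chromatic_number \<Gamma> = 3))"
proof -
  have columns: "columns M = {y}"
    by (auto simp: assms(1) columns_def column_def columnvector_def vec_eq_iff)
  have coloring_iff: "(\<exists>c :: (int ^ 'm) set \<Rightarrow> nat. proper_coloring \<Gamma> c \<and> c ` pverts \<Gamma> \<subseteq> C) \<longleftrightarrow>
      (\<exists>g :: int ^ 'm \<Rightarrow> nat. range g \<subseteq> C \<and> (\<forall>v. g (v + y) = g v) \<and>
        (\<forall>v i. g (v + axis i 1) \<noteq> g v))" for C
    using ex_proper_coloring_iff[where M = M and C = C] by (simp add: columns assms(2))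
  let ?cos = "\<lambda>a. heuberger_subgroup M #>\<^bsub>int_vec_group\<^esub> a"
  have loop: "\<exists>x \<in> pverts \<Gamma>. (x, x) \<in> parcs \<Gamma>" if "y = axis j 1 \<or> y = - axis j 1" for j
  proof
    show "?cos 0 \<in> pverts \<Gamma>"
      by (simp add: assms(2) pverts_standardized_abelian_cayley_graph)
    \<comment> \<open>As a column, \<open>y\<close> lies in the subgroup, so the step from 0 along
      the basis vector, up or down, returns to the same coset.\<close>
    have "?cos 0 = ?cos (0 + y)"
      by (rule r_coset_add_column[symmetric]) (simp add: columns)
    with that have "?cos 0 = ?cos (0 + axis j 1) \<or> ?cos 0 = ?cos (0 - axis j 1)" by auto
    then show "(?cos 0, ?cos 0) \<in> parcs \<Gamma>"
      unfolding assms(2) parcs_standardized_abelian_cayley_graph_iff by blast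
  qed
  then have "(\<exists>x \<in> pverts \<Gamma>. (x, x) \<in> parcs \<Gamma>) \<and>
      (\<nexists>c :: (int ^ 'm) set \<Rightarrow> 'c. proper_coloring \<Gamma> c)"
    if "\<exists>j. y = axis j 1 \<or> y = - axis j 1"
    using that unfolding proper_coloring_def by blast
  moreover have "chromatic_number \<Gamma> = 2" if "even (card {i. odd (y $ i)})"
  proof -
    have "chromatic_number \<Gamma> = enat (Suc 1)"
    proof (rule chromatic_number_eqI)
      show "\<exists>c :: _ \<Rightarrow> nat. proper_coloring \<Gamma> c \<and> c ` pverts \<Gamma> \<subseteq> {..<Suc 1}"
        unfolding coloring_iff
        using ex_2_coloring[of y] that by (simp add: even_sum_nth_iff numeral_2_eq_2)
      show "\<nexists>c :: _ \<Rightarrow> nat. proper_coloring \<Gamma> c \<and> c ` pverts \<Gamma> \<subseteq> {..<1}"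
        unfolding coloring_iff
      proof clarify
        fix g :: "int ^ 'm \<Rightarrow> nat" and i :: 'm
        assume "range g \<subseteq> {..<1}"
        \<comment> \<open>A single colour makes \<open>g\<close> constant, but a step along the
          basis vector with index \<open>i\<close> must change it.\<close>
        then have "g v = 0" for v by auto
        moreover assume "\<forall>v i. g (v + axis i 1) \<noteq> g v"
        ultimately show False by simp
      qed
    qed
    then show ?thesis by (simp add: numeral_eq_enat numeral_2_eq_2)
  qed
  moreover have "chromatic_number \<Gamma> = 3"
    if "\<nexists>j. y = axis j 1 \<or> y = - axis j 1" "odd (card {i. odd (y $ i)})"
  proof -
    have odd: "odd (\<Sum>i\<in>UNIV. y $ i)" using that(2) by (simp add: even_sum_nth_iff)
    have "chromatic_number \<Gamma> = enat (Suc 2)"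
    proof (rule chromatic_number_eqI)
      show "\<exists>c :: _ \<Rightarrow> nat. proper_coloring \<Gamma> c \<and> c ` pverts \<Gamma> \<subseteq> {..<Suc 2}"
        unfolding coloring_iff
        using ex_3_coloring[OF odd that(1)] by (simp add: numeral_3_eq_3 numeral_2_eq_2)
      show "\<nexists>c :: _ \<Rightarrow> nat. proper_coloring \<Gamma> c \<and> c ` pverts \<Gamma> \<subseteq> {..<2}"
        unfolding coloring_iff using no_2_coloring[OF odd] by blast
    qed
    then show ?thesis by (simp add: numeral_eq_enat)
  qed
  ultimately show ?thesis by blast
qed

end
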